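(* For all integers $k\geqslant 2$ and $m\geqslant 0$, the limit $$e_{k,m}=\lim_{x\to\infty}\frac{\#\mathcal N_{k,m}(x)}{x}$$ exists and is given by $$e_{k,m}= \frac{6}{\pi^2} \sum_{\substack{f\in\mathcal F \\ \omega_k(f)=m}} \frac{1}{f} \prod_{p\mid f} \Bigl(1+\frac{1}{p} \Bigr)^{-1}.$$ Moreover, uniformly for all integers $k\geqslant 2$ and $m\geqslant 0$, $$\#\mathcal N_{k,m}(x) = e_{k,m}\,x+O(x^{1/2} \log x),$$ that is, there is an absolute constant $C$ such that $|\#\mathcal N_{k,m}(x)-e_{k,m}x|\leqslant C x^{1/2}\log x$ for all real $x\geqslant 2$, all integers $k\geqslant2$ and all integers $m\geqslant0$.
   Context: For a positive integer $n$ and an integer $k\geqslant 1$, $\omega_k(n)=\#\{p \text{ prime}: p^k\,\|\, n\}$ is the number of primes dividing $n$ with multiplicity exactly $k$. For real $x$, $\mathcal N_{k,m}(x)=\{n\leqslant x: \omega_k(n)=m\}$, where $n$ runs over positive integers. $\mathcal F$ is the set of powerful numbers, i.e. positive integers all of whose prime factors have multiplicity at least $2$ (so $1\in\mathcal F$). The product over $p\mid f$ runs over the primes dividing $f$. *)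

theory Defs
  imports "HOL-Analysis.Analysis" "HOL-Computational_Algebra.Primes"
begin

definition omega_mult :: "nat \<Rightarrow> nat \<Rightarrow> nat" where
  "omega_mult k n = card {p \<in> prime_factors n. multiplicity p n = k}"

definition omega_level :: "nat \<Rightarrow> nat \<Rightarrow> real \<Rightarrow> nat set" where
  "omega_level k m x = {n. 0 < n \<and> real n \<le> x \<and> omega_mult k n = m}"

definition powerful_numbers :: "nat set" where
  "powerful_numbers = {f. 0 < f \<and> (\<forall>p\<in>prime_factors f. 2 \<le> multiplicity p f)}"

(* Lim is a definite description, so this is meaningful only once the limit
   is known to exist. *)
definition omega_density :: "nat \<Rightarrow> nat \<Rightarrow> real" where
  "omega_density k m = Lim at_top (\<lambda>x::real. real (card (omega_level k m x)) / x)"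

definition omega_density_term :: "nat \<Rightarrow> real" where
  "omega_density_term f = 1 / real f * (\<Prod>p\<in>prime_factors f. inverse (1 + 1 / real p))"

end

theory Submission
  imports Defs "HOL-Computational_Algebra.Squarefree" "HOL-Real_Asymp.Real_Asymp"
begin

text \<open>
  Every positive integer is \<open>n = f s\<close> in exactly one way with \<open>f\<close> powerful, \<open>s\<close> squarefree and
  \<open>gcd(f, s) = 1\<close>; primes dividing \<open>s\<close> divide \<open>n\<close> exactly once, so for \<open>k \<ge> 2\<close> only \<open>f\<close> matters for
  \<open>omega_k(n)\<close>. Hence the count up to \<open>x\<close> is the sum, over powerful \<open>f\<close> with \<open>omega_k(f) = m\<close>, of the
  number of squarefree \<open>s \<le> x / f\<close> coprime to \<open>f\<close> (lemma \<open>card_omega_level\<close>). The density of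
  those \<open>s\<close> is \<open>6/pi^2\<close> times the product of \<open>(1 + 1/p)^(-1)\<close> over \<open>p | f\<close>, which gives the main term;
  what needs care is that the errors add up to only \<open>x^(1/2) log x\<close>.

  For \<open>f = 1\<close> the classical argument with the Moebius function gives an error at most \<open>4 sqrt y\<close> in
  counting squarefree numbers up to any \<open>y > 0\<close> (\<open>card_squarefree_asymptotic\<close>). The primes of \<open>f\<close>
  are then excluded one at a time. Each exclusion multiplies the bound by \<open>1 / (1 - p^(-sigma))\<close> when
  the error is measured by \<open>y^sigma\<close>, for any \<open>1/2 \<le> sigma \<le> 1\<close>
  (\<open>card_squarefree_avoiding_error\<close>). This factor is close to 1 for large \<open>p\<close>, whereas sieving
  by divisors of \<open>f\<close> would cost a factor 2 per prime and a further logarithm in the end.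

  The error bounds are summed by Rankin's trick. They hold for every \<open>y > 0\<close>, including \<open>y < 1\<close> where the
  count is 0 and the main term is itself an error; hence no truncation at \<open>f \<le> x\<close> is needed and
  the total error is at most \<open>4 x^sigma\<close> times the sum of \<open>h(f) f^(-sigma)\<close> over all powerful \<open>f\<close>,
  where \<open>h(f)\<close> is the product of \<open>1 / (1 - p^(-1/2))\<close> over \<open>p | f\<close>. Since \<open>f\<close> has the form \<open>a^2 b^3\<close> and
  \<open>h(n)\<close> is at most a constant times the sum of \<open>d^(-1/4)\<close> over \<open>d | n\<close>, that sum is
  \<open>O(1 / (2 sigma - 1))\<close>, the order of the pole of \<open>zeta(2 sigma)\<close>
  (\<open>sum_error_weight_powerful_le\<close>). The choice \<open>sigma = 1/2 + 1/(4 log x)\<close> makes \<open>x^sigma\<close> comparable to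
  \<open>x^(1/2)\<close> and \<open>1 / (2 sigma - 1)\<close> comparable to \<open>log x\<close>. Nothing here depends on \<open>k\<close> or \<open>m\<close>, so the bound
  is uniform.
\<close>

section \<open>The Moebius function\<close>

lemma prime_factors_Prod_primes:
  fixes B :: "nat set"
  assumes "finite B" "\<And>p. p \<in> B \<Longrightarrow> prime p"
  shows "prime_factors (\<Prod>B) = B"
proof -
  have "prime_factors (prod id B) = (\<Union>p\<in>B. prime_factors p)"
    using assms prime_gt_0_nat by (subst prime_factors_prod) force+
  then show ?thesis using assms(2) by (auto simp: prime_prime_factors)
qed

lemma multiplicity_Prod_primes:
  fixes B :: "nat set"
  assumes "finite B" "\<And>p. p \<in> B \<Longrightarrow> prime p" "prime q"
  shows "multiplicity q (\<Prod>B) = (if q \<in> B then 1 else 0)"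
  using multiplicity_prod_prime_powers[of B q "\<lambda>_. 1"] assms by simp

text \<open>
  This turns sums over squarefree divisors into sums over sets of primes, which are expanded products.
  It serves both the cancellation of the Moebius function and the divisor bound for the error weights.
\<close>
lemma bij_betw_Prod_squarefree_divisors:
  fixes n :: nat
  assumes "n > 0"
  shows "bij_betw \<Prod> (Pow (prime_factors n)) {d. d dvd n \<and> squarefree d}"
proof (rule bij_betw_byWitness[where f' = prime_factors])
  have B: "finite B" "\<And>p. p \<in> B \<Longrightarrow> prime p" if "B \<in> Pow (prime_factors n)" for B
    using that by (auto intro: finite_subset)
  show "\<forall>B\<in>Pow (prime_factors n). prime_factors (\<Prod>B) = B"
    by (intro ballI prime_factors_Prod_primes) (use B in auto)
  show "\<forall>d\<in>{d. d dvd n \<and> squarefree d}. \<Prod>(prime_factors d) = d"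
  proof
    fix d assume "d \<in> {d. d dvd n \<and> squarefree d}"
    then have d: "squarefree d" "d \<noteq> 0" using assms by auto
    then have "(\<Prod>p\<in>prime_factors d. p ^ multiplicity p d) = \<Prod>(prime_factors d)"
      by (intro prod.cong) (auto simp: squarefree_factorial_semiring')
    then show "\<Prod>(prime_factors d) = d"
      using d by (simp add: prod_prime_factors)
  qed
  show "prime_factors ` {d. d dvd n \<and> squarefree d} \<subseteq> Pow (prime_factors n)"
    using assms dvd_prime_factors by blast
  show "\<Prod> ` Pow (prime_factors n) \<subseteq> {d. d dvd n \<and> squarefree d}"
  proof safe
    fix B assume B': "B \<subseteq> prime_factors n"
    then have *: "finite B" "\<And>p. p \<in> B \<Longrightarrow> prime p" using B by auto
    have nz: "\<Prod>B \<noteq> 0" using * prime_gt_0_nat by force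
    show "squarefree (\<Prod>B)"
      using * nz by (subst squarefree_factorial_semiring') (auto simp: prime_factors_Prod_primes multiplicity_Prod_primes)
    show "\<Prod>B dvd n"
    proof (rule multiplicity_le_imp_dvd[OF nz])
      fix p :: nat assume "prime p"
      then show "multiplicity p (\<Prod>B) \<le> multiplicity p n"
        using * B' by (auto simp: multiplicity_Prod_primes prime_factors_multiplicity)
    qed
  qed
qed

definition moebius_mu :: "nat \<Rightarrow> real" where
  "moebius_mu n = (if squarefree n then (-1) ^ card (prime_factors n) else 0)"

lemma abs_moebius_mu_le_1: "\<bar>moebius_mu n\<bar> \<le> 1"
  by (simp add: moebius_mu_def power_abs)

text \<open>
  The sum over sets of prime factors of \<open>n\<close> is the expansion of the product of \<open>1 - 1\<close> over those primes.
\<close>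
lemma sum_moebius_mu_divisors:
  assumes "n > 0"
  shows "(\<Sum>d | d dvd n. moebius_mu d) = (if n = 1 then 1 else 0)"
proof -
  have fin: "finite {d. d dvd n}" using assms by simp
  have "(\<Sum>d | d dvd n. moebius_mu d) = (\<Sum>d | d dvd n \<and> squarefree d. (-1) ^ card (prime_factors d))"
    using fin by (intro sum.mono_neutral_cong_right) (auto simp: moebius_mu_def)
  also have "\<dots> = (\<Sum>B\<in>Pow (prime_factors n). (-1) ^ card (prime_factors (\<Prod>B)))"
    by (rule sum.reindex_bij_betw[OF bij_betw_Prod_squarefree_divisors[OF assms], symmetric])
  also have "\<dots> = (\<Sum>B\<in>Pow (prime_factors n). (-1) ^ card B)"
  proof (rule sum.cong[OF refl])
    fix B assume "B \<in> Pow (prime_factors n)"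
    then have "finite B" "\<And>p. p \<in> B \<Longrightarrow> prime p" by (auto intro: finite_subset)
    then show "(-1) ^ card (prime_factors (\<Prod>B)) = ((-1) ^ card B :: real)"
      by (simp add: prime_factors_Prod_primes)
  qed
  also have "\<dots> = (\<Prod>p\<in>prime_factors n. (1::real) - 1)"
    by (subst prod_diff_conv_sum) auto
  also have "\<dots> = (if n = 1 then 1 else 0)"
    using assms by (cases "prime_factors n = {}") (auto simp: prime_factorization_empty_iff card_gt_0_iff power_0_left)
  finally show ?thesis .
qed

text \<open>
  The \<open>d\<close> with \<open>d\<^sup>2 dvd n\<close> are the divisors of \<open>square_part n\<close>, which is 1 exactly for squarefree \<open>n\<close>.
\<close>
lemma sum_moebius_mu_square_divisors:
  assumes "n > 0"
  shows "(\<Sum>d | d\<^sup>2 dvd n. moebius_mu d) = (if squarefree n then 1 else 0)"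
proof -
  have "squarefree n \<longleftrightarrow> square_part n = 1"
  proof
    assume "squarefree n"
    then show "square_part n = 1"
      using squarefreeD[of n "square_part n"] square_part_square_dvd[of n] by (metis nat_dvd_1_iff_1)
  next
    assume "square_part n = 1"
    then show "squarefree n"
      by (intro squarefreeI) (simp flip: dvd_square_part_iff)
  qed
  moreover have "(\<Sum>d | d\<^sup>2 dvd n. moebius_mu d) = (\<Sum>d | d dvd square_part n. moebius_mu d)"
    by (simp add: dvd_square_part_iff)
  moreover have "square_part n > 0"
    using assms square_part_0_iff[of n] by linarith
  ultimately show ?thesis
    using sum_moebius_mu_divisors[of "square_part n"] by simp
qed

lemma bij_betw_Suc_positive: "bij_betw Suc UNIV {0<..}"
  by (rule bij_betw_byWitness[where f' = "\<lambda>n. n - 1"]) auto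

lemma inverse_squares_has_sum: "((\<lambda>n. 1 / (real n)\<^sup>2) has_sum (pi\<^sup>2 / 6)) {0<..}"
proof -
  have "(\<lambda>n. 1 / (real (Suc n))\<^sup>2) sums (pi\<^sup>2 / 6)"
    using inverse_squares_sums by (simp add: add.commute)
  then have "((\<lambda>n. 1 / (real (Suc n))\<^sup>2) has_sum (pi\<^sup>2 / 6)) UNIV"
    by (rule sums_nonneg_imp_has_sum) simp
  then show ?thesis
    by (subst (asm) has_sum_reindex_bij_betw[OF bij_betw_Suc_positive, of "\<lambda>n. 1 / (real n)\<^sup>2"])
qed

text \<open>
  Multiplying by the series of inverse squares and grouping the pairs \<open>(d, e)\<close> by \<open>n = d e\<close> leaves only
  the term \<open>n = 1\<close>, so the sum is the inverse of \<open>pi\<^sup>2 / 6\<close>.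
\<close>
lemma moebius_mu_over_squares_has_sum: "((\<lambda>d. moebius_mu d / (real d)\<^sup>2) has_sum (6 / pi\<^sup>2)) {0<..}"
proof -
  let ?q = "\<lambda>n::nat. 1 / (real n)\<^sup>2"
  let ?F = "\<lambda>(d, e). moebius_mu d / (real d)\<^sup>2 * ?q e"
  have q: "?q summable_on {0<..}"
    using has_sum_imp_summable[OF inverse_squares_has_sum] .
  have le: "\<bar>moebius_mu d / (real d)\<^sup>2\<bar> \<le> ?q d" for d
    using abs_moebius_mu_le_1[of d] by (simp add: divide_right_mono)
  have "(\<lambda>d. norm (moebius_mu d / (real d)\<^sup>2)) summable_on {0<..}"
    by (rule Infinite_Sum.abs_summable_on_comparison_test'[OF q]) (use le in simp)
  from abs_summable_summable[OF this] obtain M where M: "((\<lambda>d. moebius_mu d / (real d)\<^sup>2) has_sum M) {0<..}"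
    by (auto simp: summable_on_def)
  have "(\<lambda>(d, e). ?q d * ?q e) summable_on ({0<..} \<times> {0<..})"
  proof (rule summable_on_SigmaI)
    show "((\<lambda>e. case (d, e) of (d, e) \<Rightarrow> ?q d * ?q e) has_sum (?q d * (pi\<^sup>2 / 6))) {0<..}" for d :: nat
      using has_sum_cmult_right[OF inverse_squares_has_sum, of "?q d"] by simp
    show "(\<lambda>d. ?q d * (pi\<^sup>2 / 6)) summable_on {0<..}"
      by (rule summable_on_cmult_left) (rule q)
  qed auto
  then have "(\<lambda>x. norm (?F x)) summable_on ({0<..} \<times> {0<..})"
  proof (rule Infinite_Sum.abs_summable_on_comparison_test')
    fix x :: "nat \<times> nat"
    show "norm (?F x) \<le> (case x of (d, e) \<Rightarrow> ?q d * ?q e)"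
      using mult_right_mono[OF le, of "?q (snd x)" "fst x"] by (cases x) (simp add: abs_mult)
  qed
  then have sF: "?F summable_on ({0<..} \<times> {0<..})"
    by (rule abs_summable_summable)
  have F1: "(?F has_sum (M * (pi\<^sup>2 / 6))) ({0<..} \<times> {0<..})"
  proof (rule has_sum_SigmaI[OF _ _ sF])
    show "((\<lambda>e. ?F (d, e)) has_sum (moebius_mu d / (real d)\<^sup>2 * (pi\<^sup>2 / 6))) {0<..}" for d
      unfolding prod.case by (rule has_sum_cmult_right) (rule inverse_squares_has_sum)
    show "((\<lambda>d. moebius_mu d / (real d)\<^sup>2 * (pi\<^sup>2 / 6)) has_sum (M * (pi\<^sup>2 / 6))) {0<..}"
      by (rule has_sum_cmult_left) (rule M)
  qed
  have F2: "((\<lambda>(n, d). moebius_mu d / (real n)\<^sup>2) has_sum (M * (pi\<^sup>2 / 6))) (SIGMA n:{0<..}. {d. d dvd n})"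
    using F1
    by (subst has_sum_reindex_bij_witness[where i = "\<lambda>(d, e). (d * e, d)" and j = "\<lambda>(n, d). (d, n div d)"
          and T = "{0<..} \<times> {0<..}" and h = ?F])
       (auto simp: field_simps power2_eq_square elim!: dvdE)
  have "((\<lambda>n. (if n = 1 then 1 else 0) / (real n)\<^sup>2) has_sum (M * (pi\<^sup>2 / 6))) {0<..}"
  proof (rule has_sum_SigmaD[OF F2])
    fix n :: nat assume n: "n \<in> {0<..}"
    then have "((\<lambda>d. moebius_mu d / (real n)\<^sup>2) has_sum (\<Sum>d | d dvd n. moebius_mu d / (real n)\<^sup>2)) {d. d dvd n}"
      by (intro has_sum_finite) auto
    then show "((\<lambda>d. case (n, d) of (n, d) \<Rightarrow> moebius_mu d / (real n)\<^sup>2) has_sum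
        (if n = 1 then 1 else 0) / (real n)\<^sup>2) {d. d dvd n}"
      using n sum_moebius_mu_divisors[of n] by (simp flip: sum_divide_distrib)
  qed
  moreover have "((\<lambda>n::nat. (if n = 1 then 1 else 0) / (real n)\<^sup>2) has_sum 1) {0<..}"
    by (rule has_sum_finite_neutralI[of "{1}"]) auto
  ultimately have "M * (pi\<^sup>2 / 6) = 1" by (rule has_sum_unique)
  then have "M = 6 / pi\<^sup>2" by (simp add: field_simps)
  with M show ?thesis by simp
qed

section \<open>Counting squarefree numbers\<close>

definition squarefree_avoiding :: "nat set \<Rightarrow> real \<Rightarrow> nat set" where
  "squarefree_avoiding P y = {s. 0 < s \<and> real s \<le> y \<and> squarefree s \<and> (\<forall>p\<in>P. \<not> p dvd s)}"

lemma finite_squarefree_avoiding: "finite (squarefree_avoiding P y)"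
proof (rule finite_subset)
  show "squarefree_avoiding P y \<subseteq> {..nat \<lfloor>y\<rfloor>}"
    by (auto simp: squarefree_avoiding_def le_nat_floor)
qed simp

lemma squarefree_avoiding_eq_empty: "y < 1 \<Longrightarrow> squarefree_avoiding P y = {}"
  by (auto simp: squarefree_avoiding_def)

lemma card_multiples_upto:
  assumes "(q::nat) > 0"
  shows "card {n. 0 < n \<and> n \<le> N \<and> q dvd n} = N div q"
proof -
  have "n \<in> (\<lambda>k. q * k) ` {0<..N div q}" if "0 < n" "n \<le> N" "q dvd n" for n
  proof -
    from \<open>q dvd n\<close> obtain k where k: "n = q * k" ..
    then have "k \<le> N div q"
      using that assms by (simp add: less_eq_div_iff_mult_less_eq mult.commute)
    then show ?thesis using k that by auto
  qed
  moreover have "0 < q * k \<and> q * k \<le> N" if "k \<in> {0<..N div q}" for k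
    using that assms by (simp add: less_eq_div_iff_mult_less_eq mult.commute)
  ultimately have "{n. 0 < n \<and> n \<le> N \<and> q dvd n} = (\<lambda>k. q * k) ` {0<..N div q}"
    by (intro equalityI subsetI) auto
  moreover have "inj_on (\<lambda>k. q * k) {0<..N div q}"
    using assms by (auto intro: inj_onI)
  ultimately show ?thesis by (simp add: card_image)
qed

text \<open>
  Double counting of the pairs \<open>(n, d)\<close> with \<open>n \<le> y\<close> and \<open>d\<^sup>2 dvd n\<close>. The sum may run over all \<open>d\<close> because the
  floor vanishes for \<open>d\<^sup>2 > y\<close>; in this form it can be subtracted termwise from the main term.
\<close>
lemma card_squarefree_has_sum:
  assumes "y > 0"
  shows "((\<lambda>d. moebius_mu d * of_int \<lfloor>y / (real d)\<^sup>2\<rfloor>) has_sum real (card (squarefree_avoiding {} y))) {0<..}"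
proof -
  define N where "N = nat \<lfloor>y\<rfloor>"
  have N: "real n \<le> y \<longleftrightarrow> n \<le> N" for n
    using assms by (simp add: N_def le_nat_iff le_floor_iff)
  have "real (card (squarefree_avoiding {} y)) = (\<Sum>n\<in>{0<..N}. if squarefree n then 1 else 0)"
    by (simp add: sum.If_cases squarefree_avoiding_def N Int_def conj_assoc)
  also have "\<dots> = (\<Sum>n\<in>{0<..N}. \<Sum>d | d\<^sup>2 dvd n. moebius_mu d)"
    by (rule sum.cong) (auto simp: sum_moebius_mu_square_divisors)
  also have "\<dots> = (\<Sum>n\<in>{0<..N}. \<Sum>d\<in>{d\<in>{0<..N}. d\<^sup>2 dvd n}. moebius_mu d)"
  proof (rule sum.cong[OF refl], rule sum.cong)
    fix n assume n: "n \<in> {0<..N}"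
    have "d \<le> N \<and> d > 0" if "d\<^sup>2 dvd n" for d
    proof -
      have "d dvd n" using that by (meson dvd_trans dvd_power pos2)
      then show ?thesis using n by (auto dest: dvd_imp_le dvd_pos_nat)
    qed
    then show "{d. d\<^sup>2 dvd n} = {d\<in>{0<..N}. d\<^sup>2 dvd n}" by auto
  qed auto
  also have "\<dots> = (\<Sum>d\<in>{0<..N}. \<Sum>n\<in>{n\<in>{0<..N}. d\<^sup>2 dvd n}. moebius_mu d)"
    by (rule sum.swap_restrict) auto
  also have "\<dots> = (\<Sum>d\<in>{0<..N}. moebius_mu d * of_int \<lfloor>y / (real d)\<^sup>2\<rfloor>)"
  proof (rule sum.cong[OF refl])
    fix d assume d: "d \<in> {0<..N}"
    have "card {n\<in>{0<..N}. d\<^sup>2 dvd n} = N div d\<^sup>2"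
      using card_multiples_upto[of "d\<^sup>2" N] d by (simp add: conj_assoc)
    moreover have "\<lfloor>y / (real d)\<^sup>2\<rfloor> = int (N div d\<^sup>2)"
      using floor_divide_real_eq_div[of "int (d\<^sup>2)" y] assms by (simp add: N_def zdiv_int)
    ultimately show "(\<Sum>n\<in>{n\<in>{0<..N}. d\<^sup>2 dvd n}. moebius_mu d) = moebius_mu d * of_int \<lfloor>y / (real d)\<^sup>2\<rfloor>"
      by simp
  qed
  finally have eq: "real (card (squarefree_avoiding {} y)) = (\<Sum>d\<in>{0<..N}. moebius_mu d * of_int \<lfloor>y / (real d)\<^sup>2\<rfloor>)" .
  show ?thesis
  proof (rule has_sum_finite_neutralI[OF _ _ _ eq])
    fix d assume "d \<in> {0<..} - {0<..N}"
    then have d: "d > 0" "real d > y" using N[of d] by auto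
    have "real d * 1 \<le> real d * real d" using d by (intro mult_left_mono) auto
    then have "y < (real d)\<^sup>2" using d unfolding power2_eq_square by linarith
    then have "\<lfloor>y / (real d)\<^sup>2\<rfloor> = 0" using assms d by (simp add: floor_eq_iff)
    then show "moebius_mu d * of_int \<lfloor>y / (real d)\<^sup>2\<rfloor> = 0" by simp
  qed auto
qed

lemma abs_floor_minus_le:
  fixes z :: real
  assumes "z \<ge> 0"
  shows "\<bar>of_int \<lfloor>z\<rfloor> - z\<bar> \<le> min 1 z"
proof -
  have "0 \<le> real_of_int \<lfloor>z\<rfloor>" "real_of_int \<lfloor>z\<rfloor> \<le> z" "z < real_of_int \<lfloor>z\<rfloor> + 1"
    using assms floor_correct[of z] by simp_all
  then show ?thesis unfolding min.bounded_iff abs_le_iff by linarith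
qed

text \<open>
  A telescoping majorant that is of the right size on both sides of \<open>d = r\<close>: summed over \<open>d \<ge> 1\<close> it gives
  \<open>4 r\<close>, without splitting the range of summation and without a logarithm.
\<close>
lemma min_one_ratio_le_telescoping:
  fixes r d :: real
  assumes "r > 0" "d \<ge> 1"
  shows "min 1 (r\<^sup>2 / d\<^sup>2) \<le> 4 * r\<^sup>2 * (1 / (r + d - 1) - 1 / (r + d))"
proof -
  have pos: "r + d - 1 > 0" "r + d > 0" "d > 0" using assms by auto
  have "min 1 (r\<^sup>2 / d\<^sup>2) \<le> 4 * r\<^sup>2 / (r + d)\<^sup>2"
  proof (cases "d \<le> r")
    case True
    have "(r + d)\<^sup>2 \<le> (2 * r)\<^sup>2" using assms True by (intro power_mono) auto
    then have "1 \<le> 4 * r\<^sup>2 / (r + d)\<^sup>2" using pos by (simp add: power_mult_distrib)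
    then show ?thesis by simp
  next
    case False
    have "(r + d)\<^sup>2 \<le> (2 * d)\<^sup>2" using assms False by (intro power_mono) auto
    then have "r\<^sup>2 * (r + d)\<^sup>2 \<le> r\<^sup>2 * (4 * d\<^sup>2)"
      by (intro mult_left_mono) (auto simp: power_mult_distrib)
    then have "r\<^sup>2 / d\<^sup>2 \<le> 4 * r\<^sup>2 / (r + d)\<^sup>2" using pos by (simp add: field_simps)
    then show ?thesis by simp
  qed
  also have "\<dots> \<le> 4 * r\<^sup>2 / ((r + d - 1) * (r + d))"
    using pos by (intro divide_left_mono) (auto simp: power2_eq_square intro!: mult_right_mono)
  also have "\<dots> = 4 * r\<^sup>2 * (1 / (r + d - 1) - 1 / (r + d))"
    using pos by (simp add: field_simps)
  finally show ?thesis .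
qed

text \<open>
  Replacing each floor by its argument costs at most \<open>min 1 (y / d\<^sup>2)\<close>, and the telescoping majorant with
  \<open>r = sqrt y\<close> sums these costs. Small \<open>y\<close> are included on purpose: for \<open>y < 1\<close> the bound controls the main
  term itself.
\<close>
lemma card_squarefree_asymptotic:
  assumes "y > 0"
  shows "\<bar>real (card (squarefree_avoiding {} y)) - 6 / pi\<^sup>2 * y\<bar> \<le> 4 * sqrt y"
proof -
  define r where "r = sqrt y"
  have r: "r > 0" "y = r\<^sup>2" using assms by (auto simp: r_def)
  let ?g = "\<lambda>d. 4 * r\<^sup>2 * (1 / (r + real d - 1) - 1 / (r + real d))"
  let ?f = "\<lambda>d. moebius_mu d * of_int \<lfloor>y / (real d)\<^sup>2\<rfloor> - moebius_mu d / (real d)\<^sup>2 * y"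
  have f: "(?f has_sum (real (card (squarefree_avoiding {} y)) - 6 / pi\<^sup>2 * y)) {0<..}"
    using has_sum_add[OF card_squarefree_has_sum[OF assms]
        has_sum_uminusI[OF has_sum_cmult_left[OF moebius_mu_over_squares_has_sum, of y]]]
    by simp
  have "(\<lambda>i. 1 / (r + real i) - 1 / (r + real (Suc i))) sums (1 / (r + real 0) - 0)"
    by (rule telescope_sums') real_asymp
  then have "(\<lambda>i. 4 * r\<^sup>2 * (1 / (r + real i) - 1 / (r + real (Suc i)))) sums (4 * r\<^sup>2 * (1 / (r + real 0) - 0))"
    by (rule sums_mult)
  then have "((\<lambda>i. ?g (Suc i)) has_sum (4 * r)) UNIV"
    using r by (intro sums_nonneg_imp_has_sum) (auto simp: power2_eq_square field_simps)
  then have g: "(?g has_sum (4 * r)) {0<..}"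
    by (subst (asm) has_sum_reindex_bij_betw[OF bij_betw_Suc_positive])
  have le: "\<bar>?f d\<bar> \<le> ?g d" if "d \<in> {0<..}" for d
  proof -
    have "?f d = moebius_mu d * (of_int \<lfloor>y / (real d)\<^sup>2\<rfloor> - y / (real d)\<^sup>2)"
      by (simp add: algebra_simps)
    then have "\<bar>?f d\<bar> \<le> 1 * \<bar>of_int \<lfloor>y / (real d)\<^sup>2\<rfloor> - y / (real d)\<^sup>2\<bar>"
      by (simp only: abs_mult) (intro mult_right_mono abs_moebius_mu_le_1 abs_ge_zero)
    also have "\<dots> \<le> min 1 (r\<^sup>2 / (real d)\<^sup>2)"
      using abs_floor_minus_le[of "y / (real d)\<^sup>2"] assms r by simp
    also have "\<dots> \<le> ?g d"
      using min_one_ratio_le_telescoping[of r "real d"] r that by simp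
    finally show ?thesis .
  qed
  have "real (card (squarefree_avoiding {} y)) - 6 / pi\<^sup>2 * y \<le> 4 * r"
    using abs_le_D1[OF le] by (rule has_sum_mono[OF f g])
  moreover have "- (real (card (squarefree_avoiding {} y)) - 6 / pi\<^sup>2 * y) \<le> 4 * r"
    using abs_le_D2[OF le] by (rule has_sum_mono[OF has_sum_uminusI[OF f] g])
  ultimately show ?thesis by (simp add: r_def)
qed

section \<open>Squarefree numbers avoiding a finite set of primes\<close>

text \<open>
  A squarefree \<open>s\<close> divisible by \<open>p\<close> is \<open>p t\<close> with \<open>t\<close> squarefree and not divisible by \<open>p\<close>. Read from right to
  left this is a recursion: the count avoiding \<open>p\<close> at \<open>y\<close> is expressed by a known count and by itself at
  \<open>y / p\<close>.
\<close>
lemma card_squarefree_avoiding_insert: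
  assumes "\<And>q. q \<in> P \<Longrightarrow> prime q" "prime p" "p \<notin> P"
  shows "card (squarefree_avoiding P y) =
    card (squarefree_avoiding (insert p P) y) + card (squarefree_avoiding (insert p P) (y / real p))"
proof -
  let ?A = "squarefree_avoiding (insert p P)"
  have p: "p > 0" using assms prime_gt_0_nat by blast
  have sub: "p * t \<in> squarefree_avoiding P y" if t: "t \<in> ?A (y / real p)" for t
  proof -
    have "real (p * t) \<le> y"
      using t p by (simp add: squarefree_avoiding_def field_simps)
    moreover have "coprime p t"
      using t assms(2) by (simp add: squarefree_avoiding_def prime_imp_coprime)
    then have "squarefree (p * t)"
      using t squarefree_prime[OF assms(2)]
      by (intro squarefree_mult_coprime) (auto simp: squarefree_avoiding_def)
    moreover have "\<not> q dvd p * t" if q: "q \<in> P" for q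
    proof
      assume "q dvd p * t"
      then have "q dvd p \<or> q dvd t" using assms(1)[OF q] by (simp add: prime_dvd_mult_iff)
      moreover have "\<not> q dvd t" using t q by (auto simp: squarefree_avoiding_def)
      moreover have "\<not> q dvd p" using assms q primes_dvd_imp_eq by blast
      ultimately show False by blast
    qed
    ultimately show ?thesis
      using t p by (auto simp: squarefree_avoiding_def)
  qed
  have sup: "s \<in> (\<lambda>t. p * t) ` ?A (y / real p)" if s: "s \<in> squarefree_avoiding P y" "p dvd s" for s
  proof -
    from \<open>p dvd s\<close> obtain t where t: "s = p * t" ..
    have sf: "squarefree (p * t)" and "p * t > 0" using s t by (auto simp: squarefree_avoiding_def)
    have "\<not> p dvd t"
    proof
      assume "p dvd t"
      then have "p\<^sup>2 dvd p * t" by (simp add: power2_eq_square)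
      then have "p dvd 1" using squarefreeD[OF sf] by blast
      then show False using assms(2) by simp
    qed
    moreover have "squarefree t" using sf by (rule squarefree_multD)
    moreover have "real t \<le> y / real p"
      using s t p by (simp add: squarefree_avoiding_def field_simps)
    ultimately have "t \<in> ?A (y / real p)"
      using s t by (auto simp: squarefree_avoiding_def)
    then show ?thesis using t by blast
  qed
  have "squarefree_avoiding P y = ?A y \<union> (\<lambda>t. p * t) ` ?A (y / real p)"
  proof (intro equalityI subsetI)
    fix s assume "s \<in> squarefree_avoiding P y"
    then show "s \<in> ?A y \<union> (\<lambda>t. p * t) ` ?A (y / real p)"
      using sup[of s] by (cases "p dvd s") (auto simp: squarefree_avoiding_def)
  next
    fix s assume "s \<in> ?A y \<union> (\<lambda>t. p * t) ` ?A (y / real p)"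
    then show "s \<in> squarefree_avoiding P y"
      using sub by (auto simp: squarefree_avoiding_def)
  qed
  moreover have "?A y \<inter> (\<lambda>t. p * t) ` ?A (y / real p) = {}"
    by (auto simp: squarefree_avoiding_def)
  moreover have "inj_on (\<lambda>t. p * t) (?A (y / real p))"
    using p by (auto intro: inj_onI)
  ultimately show ?thesis
    using finite_squarefree_avoiding by (simp add: card_Un_disjoint card_image)
qed

definition avoiding_density :: "nat set \<Rightarrow> real" where
  "avoiding_density P = 6 / pi\<^sup>2 * (\<Prod>p\<in>P. inverse (1 + 1 / real p))"

definition error_factor :: "real \<Rightarrow> nat set \<Rightarrow> real" where
  "error_factor \<sigma> P = (\<Prod>p\<in>P. 1 / (1 - real p powr - \<sigma>))"

lemma avoiding_density_bounds: "0 \<le> avoiding_density P" "avoiding_density P \<le> 1"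
proof -
  have "3\<^sup>2 \<le> pi\<^sup>2" using pi_gt3 by (intro power_mono) auto
  then have "6 / pi\<^sup>2 \<le> 1" by simp
  moreover have "0 \<le> (\<Prod>p\<in>P. inverse (1 + 1 / real p))" by (intro prod_nonneg) auto
  moreover have "(\<Prod>p\<in>P. inverse (1 + 1 / real p)) \<le> 1"
    by (intro prod_le_1) (auto simp: inverse_le_1_iff)
  ultimately show "0 \<le> avoiding_density P" "avoiding_density P \<le> 1"
    unfolding avoiding_density_def by (auto intro: mult_le_one)
qed

lemma prime_powr_neg_less_1:
  assumes "prime p" "\<sigma> > 0"
  shows "real p powr - \<sigma> < 1"
  using assms prime_gt_1_nat[of p] by (simp add: powr_minus inverse_less_1_iff)

lemma error_factor_step_ge_1:
  assumes "prime p" "\<sigma> > 0"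
  shows "1 \<le> 1 / (1 - real p powr - \<sigma>)"
  using prime_powr_neg_less_1[OF assms] by simp

lemma error_factor_ge_1:
  assumes "\<And>p. p \<in> P \<Longrightarrow> prime p" "\<sigma> > 0"
  shows "1 \<le> error_factor \<sigma> P"
  unfolding error_factor_def by (intro prod_ge_1 error_factor_step_ge_1 assms)

lemma le_powr_of_le_1:
  fixes y \<sigma> :: real
  assumes "0 < y" "y \<le> 1" "\<sigma> \<le> 1"
  shows "y \<le> y powr \<sigma>"
  using powr_mono'[of \<sigma> 1 y] assms by simp

text \<open>
  For \<open>y < 1\<close> nothing is counted, and the main term is below \<open>y powr \<sigma>\<close> because \<open>\<sigma> \<le> 1\<close>. This starts the
  recursion in \<open>y\<close> below.
\<close>
lemma card_squarefree_avoiding_error_small: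
  assumes "0 < y" "y < 1" "\<sigma> \<le> 1" "\<sigma> > 0" "\<And>p. p \<in> P \<Longrightarrow> prime p"
  shows "\<bar>real (card (squarefree_avoiding P y)) - avoiding_density P * y\<bar> \<le> 4 * error_factor \<sigma> P * y powr \<sigma>"
proof -
  have "\<bar>real (card (squarefree_avoiding P y)) - avoiding_density P * y\<bar> = avoiding_density P * y"
    using assms avoiding_density_bounds[of P] by (simp add: squarefree_avoiding_eq_empty)
  also have "\<dots> \<le> 1 * y powr \<sigma>"
    using assms avoiding_density_bounds[of P] by (intro mult_mono le_powr_of_le_1) auto
  also have "\<dots> \<le> (4 * error_factor \<sigma> P) * y powr \<sigma>"
    using error_factor_ge_1[of P \<sigma>] assms by (intro mult_right_mono) auto
  finally show ?thesis .
qed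

text \<open>
  Let \<open>H\<close> be the claimed factor for \<open>insert p P\<close> and \<open>u = p powr - \<sigma>\<close>. The densities satisfy the same recursion
  as the counts, so the error at \<open>y\<close> for \<open>insert p P\<close> is at most the error for \<open>P\<close> at \<open>y\<close> plus the error for
  \<open>insert p P\<close> at \<open>y / p\<close>. By induction on \<open>P\<close> and on the size of \<open>y\<close> these are at most \<open>(1 - u) H\<close> and \<open>u H\<close>
  times \<open>4 * y powr \<sigma>\<close>, which add up to the claim.
\<close>
lemma card_squarefree_avoiding_error:
  assumes "finite P" "\<And>p. p \<in> P \<Longrightarrow> prime p" "1 / 2 \<le> \<sigma>" "\<sigma> \<le> 1" "y > 0"
  shows "\<bar>real (card (squarefree_avoiding P y)) - avoiding_density P * y\<bar> \<le> 4 * error_factor \<sigma> P * y powr \<sigma>"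
  using assms(1,2,5)
proof (induction P arbitrary: y rule: finite_induct)
  case empty
  show ?case
  proof (cases "y < 1")
    case True
    then show ?thesis using card_squarefree_avoiding_error_small[of y \<sigma> "{}"] empty assms by simp
  next
    case False
    then have "sqrt y \<le> y powr \<sigma>"
      using assms by (simp add: powr_half_sqrt[symmetric] powr_mono)
    then show ?thesis
      using card_squarefree_asymptotic[of y] empty
      by (simp add: avoiding_density_def error_factor_def)
  qed
next
  case (insert p P)
  let ?E = "\<lambda>P y. real (card (squarefree_avoiding P y)) - avoiding_density P * y"
  let ?c = "4 * error_factor \<sigma> (insert p P)"
  have p: "prime p" "p > 1" using insert.prems prime_gt_1_nat by auto
  define u where "u = real p powr - \<sigma>"
  have u: "0 < u" "u < 1" using p assms prime_powr_neg_less_1[of p \<sigma>] by (auto simp: u_def)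
  have factor: "error_factor \<sigma> P = (1 - u) * error_factor \<sigma> (insert p P)"
    using insert.hyps u by (simp add: error_factor_def u_def)
  have density: "avoiding_density P = (1 + 1 / real p) * avoiding_density (insert p P)"
    using insert.hyps p by (simp add: avoiding_density_def field_simps add_nonneg_eq_0_iff)
  \<comment> \<open>Dividing \<open>y\<close> by \<open>p \<ge> 2\<close> lowers the exponent \<open>n\<close>, so induction on \<open>n\<close> follows the recursion.\<close>
  have "\<bar>?E (insert p P) y\<bar> \<le> ?c * y powr \<sigma>" if "0 < y" "y < 2 ^ n" for n y
    using that
  proof (induction n arbitrary: y)
    case 0
    then show ?case
      using insert.prems assms by (intro card_squarefree_avoiding_error_small) auto
  next
    case (Suc n)
    have "2 * 2 ^ n \<le> real p * 2 ^ n" using p by (intro mult_right_mono) auto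
    then have "y < real p * 2 ^ n" using Suc.prems(2) unfolding power_Suc by linarith
    then have small: "0 < y / real p" "y / real p < 2 ^ n"
      using p Suc.prems by (auto simp: field_simps)
    have "?E (insert p P) y = ?E P y - ?E (insert p P) (y / real p)"
      using card_squarefree_avoiding_insert[of P p y] insert p density
      by (simp add: field_simps)
    then have "\<bar>?E (insert p P) y\<bar> \<le> \<bar>?E P y\<bar> + \<bar>?E (insert p P) (y / real p)\<bar>"
      by linarith
    also have "\<dots> \<le> 4 * error_factor \<sigma> P * y powr \<sigma> + ?c * (y / real p) powr \<sigma>"
      using insert.IH[of y] insert.prems Suc.prems by (intro add_mono Suc.IH small) auto
    also have "(y / real p) powr \<sigma> = u * y powr \<sigma>"
      using p Suc.prems by (simp add: u_def powr_divide powr_minus field_simps)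
    also have "4 * error_factor \<sigma> P * y powr \<sigma> + ?c * (u * y powr \<sigma>) = ?c * y powr \<sigma>"
      by (simp add: factor algebra_simps)
    finally show ?case .
  qed
  moreover obtain n where "y < 2 ^ n" using real_arch_pow[of 2 y] by auto
  ultimately show ?case using insert.prems by blast
qed

section \<open>Error weights summed over powerful numbers\<close>

text \<open>
  The integral comparison for \<open>t powr - s\<close> on \<open>[n, n + 1]\<close>, in the form of the mean value theorem.
\<close>
lemma powr_neg_Suc_le:
  assumes "s > 1" "n > 0"
  shows "real (Suc n) powr - s \<le> (real n powr (1 - s) - real (Suc n) powr (1 - s)) / (s - 1)"
proof -
  have "\<exists>z>real n. z < real (Suc n) \<and> real (Suc n) powr (1 - s) - real n powr (1 - s) =
      (real (Suc n) - real n) * ((1 - s) * z powr (1 - s - 1))"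
    by (rule MVT2) (use assms in simp, rule has_real_derivative_powr, use assms in linarith)
  then obtain z where z: "real n < z" "z < real (Suc n)"
    "real (Suc n) powr (1 - s) - real n powr (1 - s) = (1 - s) * z powr - s"
    by auto
  have "real (Suc n) powr - s \<le> z powr - s"
    using z assms by (intro powr_mono2') auto
  also have "\<dots> = (real n powr (1 - s) - real (Suc n) powr (1 - s)) / (s - 1)"
    using z assms by (simp add: field_simps)
  finally show ?thesis .
qed

text \<open>
  The bound \<open>s / (s - 1) = 1 + 1 / (s - 1)\<close> for the zeta function is stated for finite partial sums because
  all later estimates stay with finite sums until the very end.
\<close>
lemma sum_powr_neg_le:
  assumes "s > 1" "finite A" "0 \<notin> A"
  shows "(\<Sum>n\<in>A. real n powr - s) \<le> s / (s - 1)"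
proof -
  have *: "(\<Sum>n\<in>{0<..Suc N}. real n powr - s) \<le> s / (s - 1) - real (Suc N) powr (1 - s) / (s - 1)" for N
  proof (induction N)
    case 0
    have "{0<..Suc 0} = {Suc 0}" by auto
    then show ?case using assms by (simp flip: diff_divide_distrib)
  next
    case (Suc N)
    have "{0<..Suc (Suc N)} = insert (Suc (Suc N)) {0<..Suc N}" by auto
    then show ?case
      using Suc powr_neg_Suc_le[OF assms(1), of "Suc N"] by (simp add: diff_divide_distrib)
  qed
  have "A \<subseteq> {0<..Suc (Max A)}"
  proof
    fix n assume n: "n \<in> A"
    then have "n \<le> Max A" using assms(2) by simp
    moreover have "n \<noteq> 0" using n assms(3) by metis
    ultimately have "n \<le> Max A" "n > 0" by simp_all
    then show "n \<in> {0<..Suc (Max A)}" by simp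
  qed
  then have "(\<Sum>n\<in>A. real n powr - s) \<le> (\<Sum>n\<in>{0<..Suc (Max A)}. real n powr - s)"
    by (intro sum_mono2) auto
  also have "\<dots> \<le> s / (s - 1)"
    using *[of "Max A"] assms by (smt (verit) divide_nonneg_pos powr_ge_zero)
  finally show ?thesis .
qed

text \<open>
  With \<open>v = p powr (1 / 4)\<close> the estimate without the factor 4 amounts to \<open>v + 1 \<le> v\<^sup>2\<close>, that is, \<open>v\<close> is at least
  the golden ratio; this holds from \<open>p = 7\<close> on, and the primes below 7 are absorbed in the constant.
\<close>
lemma error_factor_prime_le:
  assumes "prime p"
  shows "1 / (1 - real p powr - (1 / 2)) \<le> (if p < 7 then 4 else 1) * (1 + real p powr - (1 / 4))"
proof -
  define v where "v = real p powr (1 / 4)"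
  have p: "p \<ge> 2" using assms prime_ge_2_nat by auto
  have v2: "v\<^sup>2 = sqrt (real p)"
    by (simp add: v_def power2_eq_square powr_half_sqrt flip: powr_add)
  have v2': "real p powr - (1 / 2) = 1 / v\<^sup>2"
    by (simp only: v2 powr_minus powr_half_sqrt of_nat_0_le_iff inverse_eq_divide)
  have v1: "real p powr - (1 / 4) = 1 / v" "v > 0"
    using p by (simp_all add: v_def powr_minus field_simps)
  have "4 / 3 \<le> sqrt (real p)"
    using p by (intro real_le_rsqrt) (simp add: power2_eq_square)
  then have w: "4 / 3 \<le> v\<^sup>2" using v2 by simp
  show ?thesis
  proof (cases "p < 7")
    case True
    have "1 / v\<^sup>2 \<le> 3 / 4"
      using w v1 by (simp add: divide_le_eq)
    then have "1 / (1 - 1 / v\<^sup>2) \<le> 1 / (1 / 4)"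
      by (intro divide_left_mono) auto
    then have "1 / (1 - 1 / v\<^sup>2) \<le> 4" by simp
    also have "\<dots> \<le> 4 * (1 + 1 / v)" using v1 by simp
    finally show ?thesis using True v1 v2' by simp
  next
    case False
    \<comment> \<open>\<open>81 / 50\<close> lies just above the golden ratio, and its fourth power is still below 7.\<close>
    have "81 / 50 \<le> v"
    proof (rule power_le_imp_le_base[of _ 3])
      have "v ^ Suc 3 = (v\<^sup>2)\<^sup>2" by simp
      also have "\<dots> = real p" by (simp add: v2)
      finally show "(81 / 50) ^ Suc 3 \<le> v ^ Suc 3" using False by (simp add: power_divide)
    qed (use v1 in simp)
    then have "0 \<le> (v - 81 / 50) * (v + 31 / 50)" by simp
    then have key: "v + 1 \<le> v\<^sup>2" by (simp add: power2_eq_square algebra_simps)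
    have "1 / v\<^sup>2 < 1" using v1 key by (simp add: divide_less_eq)
    have "(1 + 1 / v) * (1 - 1 / v\<^sup>2) - 1 = (v\<^sup>2 - (v + 1)) / v ^ 3"
      using v1 by (simp add: field_simps power2_eq_square power3_eq_cube)
    also have "\<dots> \<ge> 0" using key v1 by simp
    finally have "1 \<le> (1 + 1 / v) * (1 - 1 / v\<^sup>2)" by simp
    then have "1 / (1 - 1 / v\<^sup>2) \<le> 1 + 1 / v"
      using \<open>1 / v\<^sup>2 < 1\<close> by (subst pos_divide_le_eq) auto
    then show ?thesis using False v1 v2' by simp
  qed
qed

text \<open>
  Expanding the product gives exactly the squarefree divisors.
\<close>
lemma prod_prime_factors_le_sum_divisors:
  assumes "n > 0"
  shows "(\<Prod>p\<in>prime_factors n. 1 + real p powr a) \<le> (\<Sum>d | d dvd n. real d powr a)"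
proof -
  have "(\<Prod>p\<in>prime_factors n. 1 + real p powr a) = (\<Sum>B\<in>Pow (prime_factors n). \<Prod>p\<in>B. real p powr a)"
    by (subst add.commute, subst prod_add) auto
  also have "\<dots> = (\<Sum>B\<in>Pow (prime_factors n). real (\<Prod>B) powr a)"
  proof (rule sum.cong[OF refl])
    fix B
    show "(\<Prod>p\<in>B. real p powr a) = real (\<Prod>B) powr a"
      by (simp add: prod_powr_distrib)
  qed
  also have "\<dots> = (\<Sum>d | d dvd n \<and> squarefree d. real d powr a)"
    by (rule sum.reindex_bij_betw[OF bij_betw_Prod_squarefree_divisors[OF assms]])
  also have "\<dots> \<le> (\<Sum>d | d dvd n. real d powr a)"
    using assms by (intro sum_mono2) auto
  finally show ?thesis .
qed

text \<open>
  The value at \<open>\<sigma> = 1 / 2\<close> is the largest one in the range of \<open>\<sigma>\<close> under consideration. Fixing it makes the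
  weight independent of \<open>\<sigma>\<close>, and so independent of \<open>x\<close>.
\<close>
definition error_weight :: "nat \<Rightarrow> real" where
  "error_weight n = error_factor (1 / 2) (prime_factors n)"

lemma error_weight_ge_1: "1 \<le> error_weight n"
  unfolding error_weight_def by (rule error_factor_ge_1) auto

lemma error_factor_le_error_weight:
  assumes "1 / 2 \<le> \<sigma>"
  shows "error_factor \<sigma> (prime_factors n) \<le> error_weight n"
  unfolding error_weight_def error_factor_def
proof (rule prod_mono)
  fix p assume "p \<in> prime_factors n"
  then have p: "prime p" "p > 1" using prime_gt_1_nat by auto
  have "real p powr - \<sigma> \<le> real p powr - (1 / 2)"
    using p assms by (intro powr_mono) auto
  then show "0 \<le> 1 / (1 - real p powr - \<sigma>) \<and> 1 / (1 - real p powr - \<sigma>) \<le> 1 / (1 - real p powr - (1 / 2))"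
    using p assms prime_powr_neg_less_1[of p \<sigma>] prime_powr_neg_less_1[of p "1/2"]
    by (auto intro!: divide_left_mono mult_pos_pos)
qed

text \<open>
  The weight is a divisor sum that is bounded on average, so averaging it against \<open>n powr - s\<close> keeps a
  simple pole at \<open>s = 1\<close>; a pointwise bound of the form \<open>n powr \<epsilon>\<close> would not. The exponent 7 bounds the number of
  primes below 7 crudely.
\<close>
lemma error_weight_le_sum_divisors:
  assumes "n > 0"
  shows "error_weight n \<le> 4 ^ 7 * (\<Sum>d | d dvd n. real d powr - (1 / 4))"
proof -
  have "error_weight n \<le> (\<Prod>p\<in>prime_factors n. (if p < 7 then 4 else 1) * (1 + real p powr - (1 / 4)))"
    unfolding error_weight_def error_factor_def
  proof (rule prod_mono)
    fix p assume "p \<in> prime_factors n"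
    then have "prime p" by auto
    then show "0 \<le> 1 / (1 - real p powr - (1 / 2)) \<and>
        1 / (1 - real p powr - (1 / 2)) \<le> (if p < 7 then 4 else 1) * (1 + real p powr - (1 / 4))"
      using error_factor_prime_le[of p] order_trans[OF zero_le_one error_factor_step_ge_1[of p "1 / 2"]]
      by (intro conjI) simp_all
  qed
  also have "\<dots> = (\<Prod>p\<in>prime_factors n. if p < 7 then 4 else 1) * (\<Prod>p\<in>prime_factors n. 1 + real p powr - (1 / 4))"
    by (rule prod.distrib)
  also have "(\<Prod>p\<in>prime_factors n. if p < 7 then 4 else 1) = (4 :: real) ^ card (prime_factors n \<inter> {p. p < 7})"
    by (simp add: prod.If_cases)
  also have "\<dots> * (\<Prod>p\<in>prime_factors n. 1 + real p powr - (1 / 4)) \<le>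
      4 ^ 7 * (\<Sum>d | d dvd n. real d powr - (1 / 4))"
  proof (intro mult_mono prod_prime_factors_le_sum_divisors assms)
    have "card (prime_factors n \<inter> {p. p < 7}) \<le> card {..<7::nat}"
      by (intro card_mono) auto
    then show "(4 :: real) ^ card (prime_factors n \<inter> {p. p < 7}) \<le> 4 ^ 7"
      by (intro power_increasing) auto
  qed (auto intro!: prod_nonneg add_nonneg_nonneg)
  finally show ?thesis .
qed

text \<open>
  After inserting the divisor sum and writing \<open>n = d e\<close>, the sum is dominated by a product of two zeta sums,
  at \<open>s + 1 / 4\<close> (bounded by 5 for \<open>s > 1\<close>) and at \<open>s\<close>.
\<close>
lemma sum_error_weight_le:
  assumes "s > 1" "finite A" "0 \<notin> A"
  shows "(\<Sum>n\<in>A. error_weight n * real n powr - s) \<le> 5 * 4 ^ 7 * (s / (s - 1))"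
proof -
  define D where "D = (\<Union>n\<in>A. {d. d dvd n})"
  have pos: "n > 0" if "n \<in> A" for n using that assms by (cases n) auto
  have D: "finite D" "0 \<notin> D" using assms pos by (auto simp: D_def)
  have "(\<Sum>n\<in>A. error_weight n * real n powr - s) \<le>
      (\<Sum>n\<in>A. 4 ^ 7 * (\<Sum>d | d dvd n. real d powr - (1 / 4)) * real n powr - s)"
    using pos by (intro sum_mono mult_right_mono error_weight_le_sum_divisors) auto
  also have "\<dots> = 4 ^ 7 * (\<Sum>n\<in>A. \<Sum>d | d dvd n. real d powr - (1 / 4) * real n powr - s)"
    by (simp add: sum_distrib_left sum_distrib_right mult.assoc)
  also have "(\<Sum>n\<in>A. \<Sum>d | d dvd n. real d powr - (1 / 4) * real n powr - s) =
      (\<Sum>(n, d)\<in>(SIGMA n:A. {d. d dvd n}). real d powr - (1 / 4) * real n powr - s)"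
    using assms pos by (intro sum.Sigma) auto
  also have "\<dots> = (\<Sum>(d, e)\<in>(\<lambda>(n, d). (d, n div d)) ` (SIGMA n:A. {d. d dvd n}).
      real d powr - (s + 1 / 4) * real e powr - s)"
  proof (rule sum.reindex_cong[symmetric, OF _ refl])
    show "inj_on (\<lambda>(n, d). (d, n div d)) (SIGMA n:A. {d. d dvd n})"
      by (rule inj_onI) (auto elim!: dvdE)
    fix x assume x: "x \<in> (SIGMA n:A. {d. d dvd n})"
    obtain n d where nd: "x = (n, d)" by fastforce
    with x obtain e where e: "n = d * e" by (auto elim: dvdE)
    with x nd pos[of n] have "d > 0" "e > 0" by auto
    have "real n powr - s = real d powr - s * real e powr - s" by (simp add: e powr_mult)
    moreover have "real d powr - (s + 1 / 4) = real d powr - (1 / 4) * real d powr - s"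
      unfolding powr_add[symmetric] by (rule arg_cong[where f = "\<lambda>t. real d powr t"]) simp
    ultimately show "(case case x of (n, d) \<Rightarrow> (d, n div d) of (d, e) \<Rightarrow> real d powr - (s + 1 / 4) * real e powr - s) =
        (case x of (n, d) \<Rightarrow> real d powr - (1 / 4) * real n powr - s)"
      using \<open>d > 0\<close> by (simp add: nd e mult_ac)
  qed
  also have "\<dots> \<le> (\<Sum>(d, e)\<in>D \<times> D. real d powr - (s + 1 / 4) * real e powr - s)"
  proof (rule sum_mono2)
    show "(\<lambda>(n, d). (d, n div d)) ` (SIGMA n:A. {d. d dvd n}) \<subseteq> D \<times> D"
    proof safe
      fix n d assume nd: "n \<in> A" "d dvd n"
      then have "n div d dvd n" by (metis dvd_div_mult_self dvd_triv_left)
      with nd show "d \<in> D" "n div d \<in> D" by (auto simp: D_def)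
    qed
  qed (use D in auto)
  also have "\<dots> = (\<Sum>d\<in>D. real d powr - (s + 1 / 4)) * (\<Sum>e\<in>D. real e powr - s)"
    by (simp add: sum_product sum.cartesian_product)
  also have "\<dots> \<le> 5 * (s / (s - 1))"
  proof (intro mult_mono sum_powr_neg_le assms D)
    have "(\<Sum>d\<in>D. real d powr - (s + 1 / 4)) \<le> (s + 1 / 4) / (s + 1 / 4 - 1)"
      using assms D by (intro sum_powr_neg_le) auto
    also have "\<dots> \<le> 5" using assms by (simp add: field_simps)
    finally show "(\<Sum>d\<in>D. real d powr - (s + 1 / 4)) \<le> 5" .
  qed (auto intro: sum_nonneg)
  finally show ?thesis by simp
qed

text \<open>
  Write \<open>f = b q\<^sup>2\<close> with \<open>b\<close> squarefree. A prime dividing \<open>b\<close> has odd multiplicity in \<open>f\<close>, hence at least 3 since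
  \<open>f\<close> is powerful, so it divides \<open>q\<close>; thus \<open>b\<close> divides \<open>q\<close>.
\<close>
lemma powerful_eq_square_times_cube:
  assumes "f \<in> powerful_numbers"
  obtains a b where "f = a\<^sup>2 * b ^ 3"
proof -
  define b where "b = squarefree_part f"
  define q where "q = square_part f"
  have f: "f > 0" "f = b * q\<^sup>2"
    using assms squarefree_decompose[of f] by (auto simp: powerful_numbers_def b_def q_def)
  then have nz: "b \<noteq> 0" "q \<noteq> 0" by auto
  have "b dvd q"
  proof (rule multiplicity_le_imp_dvd[OF nz(1)])
    fix p :: nat assume p: "prime p"
    have "multiplicity p f = 0 \<or> multiplicity p f \<ge> 2"
      using assms p by (auto simp: powerful_numbers_def prime_factors_multiplicity)
    then show "multiplicity p b \<le> multiplicity p q"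
      using p by (auto simp: b_def q_def prime_multiplicity_squarefree_part prime_multiplicity_square_part)
  qed
  then obtain a where "q = b * a" ..
  with f have "f = a\<^sup>2 * b ^ 3"
    by (simp add: power2_eq_square power3_eq_cube mult_ac)
  then show ?thesis by (rule that)
qed

lemma error_weight_square_cube_le:
  "error_weight (a\<^sup>2 * b ^ 3) \<le> error_weight a * error_weight b"
proof (cases "a = 0 \<or> b = 0")
  case True
  then have "error_weight (a\<^sup>2 * b ^ 3) = 1" by (auto simp: error_weight_def error_factor_def)
  then show ?thesis
    using mult_mono[OF error_weight_ge_1[of a] error_weight_ge_1[of b]] error_weight_ge_1[of a] by simp
next
  case False
  let ?h = "\<lambda>p. 1 / (1 - real p powr - (1 / 2))"
  let ?A = "prime_factors a" and ?B = "prime_factors b"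
  have h: "1 \<le> ?h p" if "p \<in> ?A \<union> ?B" for p
    using that by (intro error_factor_step_ge_1) auto
  have "prime_factors (a\<^sup>2 * b ^ 3) = ?A \<union> ?B"
    using False by (auto simp: in_prime_factors_iff prime_dvd_mult_iff prime_dvd_power_iff)
  then have "error_weight (a\<^sup>2 * b ^ 3) = prod ?h (?A \<union> (?B - ?A))"
    by (simp add: error_weight_def error_factor_def)
  also have "\<dots> = prod ?h ?A * prod ?h (?B - ?A)"
    by (rule prod.union_disjoint) auto
  also have "\<dots> \<le> prod ?h ?A * prod ?h ?B"
  proof (intro mult_left_mono prod_mono2)
    show "0 \<le> prod ?h ?A"
      using h by (intro prod_nonneg) (meson UnI1 order_trans zero_le_one)
    show "0 \<le> ?h p" if "p \<in> ?B - ?A" for p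
      using h[of p] that by (meson DiffD1 UnI2 order_trans zero_le_one)
  qed (use h in auto)
  finally show ?thesis by (simp add: error_weight_def error_factor_def)
qed

text \<open>
  Two factors \<open>5 * 4 ^ 7\<close> come from the weighted zeta sums at \<open>2 \<sigma>\<close> and \<open>3 \<sigma>\<close>, and 6 bounds the product
  of \<open>2 \<sigma>\<close> and \<open>3 \<sigma> / (3 \<sigma> - 1)\<close> for \<open>1 / 2 < \<sigma> \<le> 1\<close>.
\<close>
definition rankin_constant :: real where
  "rankin_constant = 6 * (5 * 4 ^ 7)\<^sup>2"

text \<open>
  Through \<open>f = a\<^sup>2 b\<^sup>3\<close> the sum is at most the product of a weighted zeta sum at \<open>2 \<sigma>\<close> over the \<open>a\<close> and one at
  \<open>3 \<sigma>\<close> over the \<open>b\<close>. Only the first has a pole at \<open>\<sigma> = 1 / 2\<close>, and it is simple: this is where the single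
  logarithm of the theorem comes from.
\<close>
lemma sum_error_weight_powerful_le:
  assumes "1 / 2 < \<sigma>" "\<sigma> \<le> 1" "finite A" "A \<subseteq> powerful_numbers"
  shows "(\<Sum>f\<in>A. error_weight f * real f powr - \<sigma>) \<le> rankin_constant / (2 * \<sigma> - 1)"
proof -
  have "\<forall>f\<in>A. \<exists>ab. f = (fst ab)\<^sup>2 * snd ab ^ 3"
    using assms(4) powerful_eq_square_times_cube by (metis fst_conv snd_conv subsetD)
  then obtain g where g: "\<And>f. f \<in> A \<Longrightarrow> f = (fst (g f))\<^sup>2 * snd (g f) ^ 3" by metis
  define B where "B = fst ` g ` A \<union> snd ` g ` A"
  have pos: "f > 0" if "f \<in> A" for f using that assms(4) by (auto simp: powerful_numbers_def)
  have gpos: "fst (g f) > 0" "snd (g f) > 0" if "f \<in> A" for f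
    using g[OF that] pos[OF that] by (metis gr0I mult_zero_left mult_zero_right zero_power zero_less_numeral)+
  have B: "finite B" "0 \<notin> B" using assms(3) gpos by (force simp: B_def)+
  let ?w = "\<lambda>s n. error_weight n * real n powr - s"
  have w: "0 \<le> ?w s n" for s n using error_weight_ge_1[of n] by simp
  have "(\<Sum>f\<in>A. ?w \<sigma> f) \<le> (\<Sum>f\<in>A. ?w (2 * \<sigma>) (fst (g f)) * ?w (3 * \<sigma>) (snd (g f)))"
  proof (rule sum_mono)
    fix f assume f: "f \<in> A"
    define a b where "a = fst (g f)" and "b = snd (g f)"
    have ab: "a > 0" "b > 0" "f = a\<^sup>2 * b ^ 3" using g[OF f] gpos[OF f] by (auto simp: a_def b_def)
    have "real f powr - \<sigma> = real a powr - (2 * \<sigma>) * real b powr - (3 * \<sigma>)"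
      using ab by (simp add: powr_mult powr_powr flip: powr_numeral)
    moreover have "?w \<sigma> f \<le> error_weight a * error_weight b * real f powr - \<sigma>"
      unfolding ab(3) by (intro mult_right_mono error_weight_square_cube_le) auto
    ultimately show "?w \<sigma> f \<le> ?w (2 * \<sigma>) (fst (g f)) * ?w (3 * \<sigma>) (snd (g f))"
      by (simp add: mult_ac flip: a_def b_def)
  qed
  also have "\<dots> = (\<Sum>(a, b)\<in>g ` A. ?w (2 * \<sigma>) a * ?w (3 * \<sigma>) b)"
  proof (subst sum.reindex)
    show "inj_on g A"
      by (rule inj_on_inverseI[where g = "\<lambda>ab. (fst ab)\<^sup>2 * snd ab ^ 3"]) (simp flip: g)
  qed (simp add: case_prod_unfold)
  also have "\<dots> \<le> (\<Sum>(a, b)\<in>B \<times> B. ?w (2 * \<sigma>) a * ?w (3 * \<sigma>) b)"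
  proof (rule sum_mono2)
    show "g ` A \<subseteq> B \<times> B" unfolding B_def by (intro subsetI) (simp add: mem_Times_iff)
    show "0 \<le> (case x of (a, b) \<Rightarrow> ?w (2 * \<sigma>) a * ?w (3 * \<sigma>) b)" for x
      using w by (cases x) (simp only: prod.case mult_nonneg_nonneg)
  qed (use B in auto)
  also have "\<dots> = (\<Sum>a\<in>B. ?w (2 * \<sigma>) a) * (\<Sum>b\<in>B. ?w (3 * \<sigma>) b)"
    by (simp add: sum_product sum.cartesian_product)
  also have "\<dots> \<le> (5 * 4 ^ 7 * (2 * \<sigma> / (2 * \<sigma> - 1))) * (5 * 4 ^ 7 * (3 * \<sigma> / (3 * \<sigma> - 1)))"
    using assms B w by (intro mult_mono sum_error_weight_le sum_nonneg) auto
  also have "\<dots> \<le> (5 * 4 ^ 7 * (2 / (2 * \<sigma> - 1))) * (5 * 4 ^ 7 * 3)"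
    using assms by (intro mult_mono divide_right_mono) (auto simp: field_simps)
  also have "\<dots> = rankin_constant / (2 * \<sigma> - 1)"
    by (simp add: rankin_constant_def power2_eq_square)
  finally show ?thesis .
qed

section \<open>Powerful times squarefree\<close>

text \<open>
  Each prime divides only one of \<open>f\<close> and \<open>s\<close>, with multiplicity at least 2 in \<open>f\<close> and at most 1 in \<open>s\<close>. So the
  primes of \<open>s\<close> are recognised in \<open>f s\<close> as those of multiplicity exactly 1, which makes the factorisation
  unique, while multiplicities \<open>k \<ge> 2\<close> are those of \<open>f\<close>.
\<close>
lemma multiplicity_powerful_times_squarefree:
  assumes "f \<in> powerful_numbers" "s \<in> squarefree_avoiding (prime_factors f) y" "prime p"
  shows "multiplicity p s = (if multiplicity p (f * s) = 1 then 1 else 0)"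
    and "k \<ge> 2 \<Longrightarrow> multiplicity p (f * s) = k \<longleftrightarrow> multiplicity p f = k"
proof -
  have pos: "f \<noteq> 0" "s \<noteq> 0" using assms by (auto simp: powerful_numbers_def squarefree_avoiding_def)
  have "squarefree s" using assms(2) by (simp add: squarefree_avoiding_def)
  then have s: "multiplicity p s \<le> 1"
    using assms(3) pos by (simp add: squarefree_factorial_semiring'')
  have f: "multiplicity p f = 0 \<or> multiplicity p f \<ge> 2"
    using assms by (auto simp: powerful_numbers_def prime_factors_multiplicity)
  have fs: "multiplicity p f = 0 \<or> multiplicity p s = 0"
  proof (cases "p \<in> prime_factors f")
    case True
    then have "\<not> p dvd s" using assms(2) by (simp add: squarefree_avoiding_def)
    then show ?thesis by (simp add: not_dvd_imp_multiplicity_0)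
  next
    case False
    then show ?thesis using assms(3) by (simp add: prime_factors_multiplicity)
  qed
  have "multiplicity p (f * s) = multiplicity p f + multiplicity p s"
    using assms(3) pos by (intro prime_elem_multiplicity_mult_distrib) auto
  then show "multiplicity p s = (if multiplicity p (f * s) = 1 then 1 else 0)"
    and "k \<ge> 2 \<Longrightarrow> multiplicity p (f * s) = k \<longleftrightarrow> multiplicity p f = k"
    using s f fs by auto
qed

lemma omega_mult_powerful_times_squarefree:
  assumes "f \<in> powerful_numbers" "s \<in> squarefree_avoiding (prime_factors f) y" "k \<ge> 2"
  shows "omega_mult k (f * s) = omega_mult k f"
proof -
  have "{p \<in> prime_factors n. multiplicity p n = k} = {p. prime p \<and> multiplicity p n = k}" for n :: nat
    using assms(3) by (auto simp: prime_factors_multiplicity)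
  moreover have "{p. prime p \<and> multiplicity p (f * s) = k} = {p. prime p \<and> multiplicity p f = k}"
    using multiplicity_powerful_times_squarefree(2)[OF assms(1,2) _ assms(3)] by (intro Collect_cong conj_cong refl)
  ultimately show ?thesis by (simp add: omega_mult_def)
qed

text \<open>
  The squarefree factor is the product of the primes that divide \<open>n\<close> exactly once.
\<close>
lemma powerful_times_squarefree_exists:
  assumes "n > 0"
  obtains f s where "f \<in> powerful_numbers" "s \<in> squarefree_avoiding (prime_factors f) (real n / real f)" "n = f * s"
proof -
  define S where "S = {p \<in> prime_factors n. multiplicity p n = 1}"
  define s where "s = \<Prod>S"
  define f where "f = n div s"
  have S: "finite S" "\<And>p. p \<in> S \<Longrightarrow> prime p" by (auto simp: S_def)
  have "S \<in> Pow (prime_factors n)" by (auto simp: S_def)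
  then have "s \<in> {d. d dvd n \<and> squarefree d}"
    unfolding s_def by (rule bij_betw_apply[OF bij_betw_Prod_squarefree_divisors[OF assms]])
  then have s: "s dvd n" "squarefree s" by auto
  then have n: "n = f * s" by (simp add: f_def)
  with assms have pos: "f > 0" "s > 0" by auto
  have mult_s: "multiplicity p s = (if multiplicity p n = 1 then 1 else 0)" if "prime p" for p
  proof -
    have "p \<in> S \<longleftrightarrow> multiplicity p n = 1" using that by (auto simp: S_def prime_factors_multiplicity)
    then show ?thesis using multiplicity_Prod_primes[OF S that] by (simp add: s_def)
  qed
  have mult_n: "multiplicity p n = multiplicity p f + multiplicity p s" if "prime p" for p
    unfolding n using that pos by (intro prime_elem_multiplicity_mult_distrib) auto
  have "f \<in> powerful_numbers"
    unfolding powerful_numbers_def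
  proof (intro CollectI conjI ballI pos)
    fix p assume "p \<in> prime_factors f"
    then have "prime p" "multiplicity p f > 0" by (auto simp: prime_factors_multiplicity)
    then show "2 \<le> multiplicity p f" using mult_s[of p] mult_n[of p] by (simp split: if_splits)
  qed
  moreover have "\<not> p dvd s" if "p \<in> prime_factors f" for p
  proof -
    have "prime p" "multiplicity p f > 0" using that by (auto simp: prime_factors_multiplicity)
    then have "multiplicity p s = 0" using mult_s[of p] mult_n[of p] by (auto split: if_splits)
    then show ?thesis using \<open>prime p\<close> pos by (auto simp: prime_multiplicity_gt_zero_iff[symmetric])
  qed
  then have "s \<in> squarefree_avoiding (prime_factors f) (real n / real f)"
    using s pos n by (simp add: squarefree_avoiding_def)
  ultimately show ?thesis using n by (rule that)
qed

lemma card_omega_level: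
  assumes "k \<ge> 2"
  shows "card (omega_level k m x) =
    (\<Sum>f | f \<in> powerful_numbers \<and> omega_mult k f = m \<and> real f \<le> x. card (squarefree_avoiding (prime_factors f) (x / real f)))"
proof -
  let ?F = "{f. f \<in> powerful_numbers \<and> omega_mult k f = m \<and> real f \<le> x}"
  let ?Q = "\<lambda>f. squarefree_avoiding (prime_factors f) (x / real f)"
  have fin: "finite ?F"
    by (rule finite_subset[of _ "{..nat \<lfloor>x\<rfloor>}"]) (auto simp: le_nat_floor)
  have "bij_betw (\<lambda>(f, s). f * s) (SIGMA f:?F. ?Q f) (omega_level k m x)"
  proof (rule bij_betwI')
    fix a b assume "a \<in> (SIGMA f:?F. ?Q f)" "b \<in> (SIGMA f:?F. ?Q f)"
    then obtain f s g t where ab: "a = (f, s)" "b = (g, t)" and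
      fs: "f \<in> powerful_numbers" "s \<in> ?Q f" and gt: "g \<in> powerful_numbers" "t \<in> ?Q g"
      by auto
    have pos: "s > 0" "t > 0" using fs gt by (auto simp: squarefree_avoiding_def)
    show "((case a of (f, s) \<Rightarrow> f * s) = (case b of (f, s) \<Rightarrow> f * s)) = (a = b)"
    proof
      assume "(case a of (f, s) \<Rightarrow> f * s) = (case b of (f, s) \<Rightarrow> f * s)"
      then have eq: "f * s = g * t" by (simp add: ab)
      have "s = t"
      proof (rule multiplicity_eq_nat[OF pos])
        fix p :: nat assume p: "prime p"
        show "multiplicity p s = multiplicity p t"
          unfolding multiplicity_powerful_times_squarefree(1)[OF fs p]
            multiplicity_powerful_times_squarefree(1)[OF gt p] eq ..
      qed
      with eq pos show "a = b" by (simp add: ab)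
    qed simp
  next
    fix a assume "a \<in> (SIGMA f:?F. ?Q f)"
    then obtain f s where a: "a = (f, s)" "f \<in> powerful_numbers" "omega_mult k f = m" "s \<in> ?Q f" by auto
    have "f > 0" "s > 0" "real f * real s \<le> x"
      using a by (auto simp: powerful_numbers_def squarefree_avoiding_def field_simps)
    then show "(case a of (f, s) \<Rightarrow> f * s) \<in> omega_level k m x"
      using omega_mult_powerful_times_squarefree[OF a(2,4) assms] a by (simp add: omega_level_def)
  next
    fix n assume n: "n \<in> omega_level k m x"
    then have "n > 0" "real n \<le> x" "omega_mult k n = m" by (auto simp: omega_level_def)
    then obtain f s where fs: "f \<in> powerful_numbers"
      "s \<in> squarefree_avoiding (prime_factors f) (real n / real f)" "n = f * s"
      using powerful_times_squarefree_exists by metis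
    have pos: "f > 0" "s > 0" using fs \<open>n > 0\<close> by auto
    have "f * 1 \<le> f * s" using pos by (intro mult_left_mono) auto
    then have "real f \<le> x" using fs \<open>real n \<le> x\<close> by linarith
    moreover have "s \<in> ?Q f"
      using fs(2) divide_right_mono[OF \<open>real n \<le> x\<close>, of "real f"] by (auto simp: squarefree_avoiding_def)
    moreover have "omega_mult k f = m"
      using omega_mult_powerful_times_squarefree[OF fs(1,2) assms] fs(3) \<open>omega_mult k n = m\<close> by simp
    ultimately show "\<exists>a\<in>(SIGMA f:?F. ?Q f). n = (case a of (f, s) \<Rightarrow> f * s)"
      using fs by (intro bexI[of _ "(f, s)"]) auto
  qed
  then have "card (omega_level k m x) = card (SIGMA f:?F. ?Q f)"
    by (simp add: bij_betw_same_card)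
  also have "\<dots> = (\<Sum>f\<in>?F. card (?Q f))"
    using fin finite_squarefree_avoiding by (intro card_SigmaI) auto
  finally show ?thesis .
qed

section \<open>The density and the error term\<close>

lemma omega_density_term_nonneg: "0 \<le> omega_density_term f"
  unfolding omega_density_term_def by (intro mult_nonneg_nonneg prod_nonneg) auto

text \<open>
  The case \<open>\<sigma> = 1\<close> of the sum over powerful numbers dominates the series.
\<close>
lemma omega_density_term_summable:
  assumes "A \<subseteq> powerful_numbers"
  shows "omega_density_term summable_on A"
proof (rule nonneg_bdd_above_summable_on)
  show "bdd_above (sum omega_density_term ` {F. F \<subseteq> A \<and> finite F})"
  proof (rule bdd_aboveI2)
    fix F assume F: "F \<in> {F. F \<subseteq> A \<and> finite F}"
    have "omega_density_term f \<le> error_weight f * real f powr - 1" if "f \<in> F" for f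
    proof -
      have "(\<Prod>p\<in>prime_factors f. inverse (1 + 1 / real p)) \<le> 1"
        by (intro prod_le_1) (auto simp: inverse_le_1_iff)
      also have "\<dots> \<le> error_weight f" by (rule error_weight_ge_1)
      finally show ?thesis
        unfolding omega_density_term_def
        by (simp add: powr_minus_divide divide_right_mono)
    qed
    then have "sum omega_density_term F \<le> (\<Sum>f\<in>F. error_weight f * real f powr - 1)"
      by (rule sum_mono)
    also have "\<dots> \<le> rankin_constant / (2 * 1 - 1)"
      using F assms by (intro sum_error_weight_powerful_le) auto
    finally show "sum omega_density_term F \<le> rankin_constant / (2 * 1 - 1)" .
  qed
qed (rule omega_density_term_nonneg)

text \<open>
  Count and main term are series over the same powerful \<open>f\<close>, and their difference is estimated term by
  term. The terms with \<open>f > x\<close> have count 0 and are covered by the error bound at \<open>x / f < 1\<close>, so they need no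
  separate tail estimate.
\<close>
lemma card_omega_level_error_rankin:
  assumes "k \<ge> 2" "x > 0" "1 / 2 < \<sigma>" "\<sigma> \<le> 1"
  shows "\<bar>real (card (omega_level k m x)) -
      6 / pi\<^sup>2 * (\<Sum>\<^sub>\<infinity>f\<in>{f \<in> powerful_numbers. omega_mult k f = m}. omega_density_term f) * x\<bar>
    \<le> 4 * x powr \<sigma> * (rankin_constant / (2 * \<sigma> - 1))"
proof -
  let ?F = "{f \<in> powerful_numbers. omega_mult k f = m}"
  let ?Q = "\<lambda>f. squarefree_avoiding (prime_factors f) (x / real f)"
  let ?S = "\<Sum>\<^sub>\<infinity>f\<in>?F. omega_density_term f"
  let ?E = "\<lambda>f. real (card (?Q f)) - 6 / pi\<^sup>2 * omega_density_term f * x"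
  let ?b = "4 * x powr \<sigma> * (rankin_constant / (2 * \<sigma> - 1))"
  have pos: "f > 0" if "f \<in> ?F" for f using that by (auto simp: powerful_numbers_def)
  have Q: "((\<lambda>f. real (card (?Q f))) has_sum real (card (omega_level k m x))) ?F"
  proof (rule has_sum_finite_neutralI)
    let ?B = "{f. f \<in> powerful_numbers \<and> omega_mult k f = m \<and> real f \<le> x}"
    show "finite ?B"
      by (rule finite_subset[of _ "{..nat \<lfloor>x\<rfloor>}"]) (auto simp: le_nat_floor)
    show "real (card (omega_level k m x)) = (\<Sum>f\<in>?B. real (card (?Q f)))"
      using card_omega_level[OF assms(1)] by simp
    fix f assume "f \<in> ?F - ?B"
    then have "f > 0" "x < real f" using pos by auto
    then show "real (card (?Q f)) = 0" by (simp add: squarefree_avoiding_eq_empty)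
  qed auto
  have "(omega_density_term has_sum ?S) ?F"
    using omega_density_term_summable[of ?F] by (auto intro: has_sum_infsum)
  then have "((\<lambda>f. 6 / pi\<^sup>2 * omega_density_term f * x) has_sum (6 / pi\<^sup>2 * ?S * x)) ?F"
    by (intro has_sum_cmult_left has_sum_cmult_right)
  from has_sum_add[OF Q has_sum_uminusI[OF this]]
  have E: "(?E has_sum (real (card (omega_level k m x)) - 6 / pi\<^sup>2 * ?S * x)) ?F" by simp
  have E_le: "\<bar>?E f\<bar> \<le> 4 * x powr \<sigma> * (error_weight f * real f powr - \<sigma>)" if "f \<in> ?F" for f
  proof -
    have f: "f > 0" using pos[OF that] .
    have "6 / pi\<^sup>2 * omega_density_term f * x = avoiding_density (prime_factors f) * (x / real f)"
      by (simp add: omega_density_term_def avoiding_density_def)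
    then have "\<bar>?E f\<bar> \<le> 4 * error_factor \<sigma> (prime_factors f) * (x / real f) powr \<sigma>"
      using card_squarefree_avoiding_error[of "prime_factors f" \<sigma> "x / real f"] assms f by auto
    also have "\<dots> \<le> 4 * error_weight f * (x / real f) powr \<sigma>"
      using assms by (intro mult_right_mono mult_left_mono error_factor_le_error_weight) auto
    also have "\<dots> = 4 * x powr \<sigma> * (error_weight f * real f powr - \<sigma>)"
      using assms f by (simp add: powr_divide powr_minus_divide)
    finally show ?thesis .
  qed
  have bound: "(\<Sum>f\<in>A. \<bar>?E f\<bar>) \<le> ?b" if "finite A" "A \<subseteq> ?F" for A
  proof -
    have "(\<Sum>f\<in>A. \<bar>?E f\<bar>) \<le> (\<Sum>f\<in>A. 4 * x powr \<sigma> * (error_weight f * real f powr - \<sigma>))"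
      using E_le that by (intro sum_mono) blast
    also have "\<dots> = 4 * x powr \<sigma> * (\<Sum>f\<in>A. error_weight f * real f powr - \<sigma>)"
      by (simp only: sum_distrib_left)
    also have "\<dots> \<le> ?b"
      using that assms by (intro mult_left_mono sum_error_weight_powerful_le) auto
    finally show ?thesis .
  qed
  have "real (card (omega_level k m x)) - 6 / pi\<^sup>2 * ?S * x \<le> ?b"
  proof (rule has_sum_le_finite_sums[OF E])
    fix A assume "finite A" "A \<subseteq> ?F"
    then show "sum ?E A \<le> ?b"
      using bound[of A] sum_abs[of ?E A] by linarith
  qed
  moreover have "- (real (card (omega_level k m x)) - 6 / pi\<^sup>2 * ?S * x) \<le> ?b"
  proof (rule has_sum_le_finite_sums[OF has_sum_uminusI[OF E]])
    fix A assume "finite A" "A \<subseteq> ?F"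
    then show "(\<Sum>f\<in>A. - ?E f) \<le> ?b"
      using bound[of A] sum_abs[of ?E A] unfolding sum_negf by linarith
  qed
  ultimately show ?thesis by (rule abs_leI)
qed

text \<open>
  Moving \<open>\<sigma>\<close> away from \<open>1 / 2\<close> by \<open>c / ln x\<close> multiplies \<open>x powr (1 / 2)\<close> by the constant \<open>exp c\<close> and makes
  \<open>1 / (2 * \<sigma> - 1)\<close> a multiple of \<open>ln x\<close>. The value \<open>c = 1 / 4\<close> is small enough for \<open>\<sigma> \<le> 1\<close> to hold already
  at \<open>x = 2\<close>.
\<close>
lemma card_omega_level_error:
  assumes "k \<ge> 2" "x \<ge> 2"
  shows "\<bar>real (card (omega_level k m x)) -
      6 / pi\<^sup>2 * (\<Sum>\<^sub>\<infinity>f\<in>{f \<in> powerful_numbers. omega_mult k f = m}. omega_density_term f) * x\<bar>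
    \<le> 16 * rankin_constant * (x powr (1 / 2) * ln x)"
proof -
  define \<sigma> where "\<sigma> = 1 / 2 + 1 / (4 * ln x)"
  have "1 / 2 \<le> ln (2::real)" using ln2_ge_two_thirds by simp
  moreover have "ln 2 \<le> ln x" using assms(2) by simp
  ultimately have ln: "1 / 2 \<le> ln x" by linarith
  then have "1 / (4 * ln x) > 0" "1 / (4 * ln x) \<le> 1 / 2" by (simp_all add: divide_le_eq)
  then have \<sigma>: "1 / 2 < \<sigma>" "\<sigma> \<le> 1" unfolding \<sigma>_def by linarith+
  have "4 * x powr \<sigma> * (rankin_constant / (2 * \<sigma> - 1)) =
      8 * exp (1 / 4) * rankin_constant * (x powr (1 / 2) * ln x)"
  proof -
    have "x powr \<sigma> = x powr (1 / 2) * x powr (1 / (4 * ln x))"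
      unfolding \<sigma>_def by (rule powr_add)
    also have "x powr (1 / (4 * ln x)) = exp (1 / 4)"
      using assms(2) ln by (simp add: powr_def)
    finally have "x powr \<sigma> = x powr (1 / 2) * exp (1 / 4)" .
    moreover have "2 * \<sigma> - 1 = 1 / (2 * ln x)" by (simp add: \<sigma>_def)
    ultimately show ?thesis by simp
  qed
  also have "\<dots> \<le> 8 * 2 * rankin_constant * (x powr (1 / 2) * ln x)"
  proof -
    have "exp (1 / 4 :: real) \<le> 2"
      using exp_bound[of "1 / 4"] by (simp add: power2_eq_square)
    moreover have "0 \<le> rankin_constant" by (simp add: rankin_constant_def)
    ultimately show ?thesis using ln by (intro mult_right_mono) auto
  qed
  finally show ?thesis
    using card_omega_level_error_rankin[OF assms(1) _ \<sigma>, of x m] assms(2) by simp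
qed

lemma omega_level_density_tendsto:
  assumes "k \<ge> 2"
  shows "((\<lambda>x::real. real (card (omega_level k m x)) / x) \<longlongrightarrow>
    6 / pi\<^sup>2 * (\<Sum>\<^sub>\<infinity>f\<in>{f \<in> powerful_numbers. omega_mult k f = m}. omega_density_term f)) at_top"
proof -
  let ?c = "6 / pi\<^sup>2 * (\<Sum>\<^sub>\<infinity>f\<in>{f \<in> powerful_numbers. omega_mult k f = m}. omega_density_term f)"
  let ?N = "\<lambda>x. real (card (omega_level k m x))"
  have "((\<lambda>x::real. ?N x / x - ?c) \<longlongrightarrow> 0) at_top"
  proof (rule Lim_null_comparison)
    show "\<forall>\<^sub>F x in at_top. norm (?N x / x - ?c) \<le> 16 * rankin_constant * (x powr (1 / 2) * ln x / x)"
      using eventually_ge_at_top[of 2]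
    proof eventually_elim
      case (elim x)
      have "?N x / x - ?c = (?N x - ?c * x) / x"
        using elim by (simp add: diff_divide_distrib)
      then have "\<bar>?N x / x - ?c\<bar> = \<bar>?N x - ?c * x\<bar> / x"
        using elim by (simp only: abs_divide abs_of_nonneg)
      also have "\<dots> \<le> 16 * rankin_constant * (x powr (1 / 2) * ln x) / x"
        using card_omega_level_error[OF assms elim] elim by (intro divide_right_mono) auto
      finally show ?case by simp
    qed
    have "((\<lambda>x::real. x powr (1 / 2) * ln x / x) \<longlongrightarrow> 0) at_top" by real_asymp
    then show "((\<lambda>x::real. 16 * rankin_constant * (x powr (1 / 2) * ln x / x)) \<longlongrightarrow> 0) at_top"
      by (rule tendsto_mult_right_zero)
  qed
  then show ?thesis by (rule LIM_zero_cancel)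
qed

theorem theorem1:
  shows "(\<forall>k\<ge>2. \<forall>m.
           ((\<lambda>x::real. real (card (omega_level k m x)) / x) \<longlongrightarrow> omega_density k m) at_top \<and>
           omega_density_term summable_on {f \<in> powerful_numbers. omega_mult k f = m} \<and>
           omega_density k m =
             6 / pi\<^sup>2 * (\<Sum>\<^sub>\<infinity>f\<in>{f \<in> powerful_numbers. omega_mult k f = m}. omega_density_term f)) \<and>
         (\<exists>C::real. \<forall>x\<ge>2. \<forall>k\<ge>2. \<forall>m.
           \<bar>real (card (omega_level k m x)) - omega_density k m * x\<bar> \<le> C * (x powr (1/2) * ln x))"
proof -
  have density: "omega_density k m =
      6 / pi\<^sup>2 * (\<Sum>\<^sub>\<infinity>f\<in>{f \<in> powerful_numbers. omega_mult k f = m}. omega_density_term f)"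
    if "k \<ge> 2" for k m
    unfolding omega_density_def
    by (rule tendsto_Lim[OF _ omega_level_density_tendsto[OF that]]) simp
  show ?thesis
  proof (intro conjI allI impI exI)
    fix k m :: nat assume k: "k \<ge> 2"
    show "((\<lambda>x::real. real (card (omega_level k m x)) / x) \<longlongrightarrow> omega_density k m) at_top"
      unfolding density[OF k] by (rule omega_level_density_tendsto[OF k])
    show "omega_density_term summable_on {f \<in> powerful_numbers. omega_mult k f = m}"
      by (rule omega_density_term_summable) auto
    show "omega_density k m =
        6 / pi\<^sup>2 * (\<Sum>\<^sub>\<infinity>f\<in>{f \<in> powerful_numbers. omega_mult k f = m}. omega_density_term f)"
      by (rule density[OF k])
  next
    fix x :: real and k m :: nat assume "x \<ge> 2" "k \<ge> 2"
    then show "\<bar>real (card (omega_level k m x)) - omega_density k m * x\<bar>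
        \<le> 16 * rankin_constant * (x powr (1/2) * ln x)"
      unfolding density[OF \<open>k \<ge> 2\<close>] by (intro card_omega_level_error)
  qed
qed

end
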